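(* Let $n\ge k>a\ge 0$ be integers. If $n\ge k(k-a+2)-a$ and $k/2>a\ge 1$, then $B(J(n,k,a))=k-a+2$.
   Context: All graphs are finite, undirected, without loops or multiple edges. In a zero forcing process, the vertices of a graph are initially colored black or white; whenever there is a black vertex adjacent to exactly one white vertex, that white vertex is forced to become black, and this is repeated as long as possible. An initial set of black vertices is a zero forcing set if eventually all vertices of the graph become black; otherwise it is a failed zero forcing set, and its complement (the initial set of white vertices) is called a zero blocking set. The zero blocking number $B(G)$ of $G$ is the minimum size of a zero blocking set of $G$. Let $[n]=\{1,2,\ldots,n\}$. For integers $n\ge k>a\ge 0$, the generalized Johnson graph $J(n,k,a)$ is the graph whose vertices are the $k$-subsets of $[n]$, where two vertices $A$ and $B$ are adjacent if and only if $|A\cap B|=a$. *)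

theory Defs
  imports Complex_Main "Graph_Theory.Pair_Digraph"
begin

text \<open>
  A finite simple graph is a \<^locale>\<open>pair_graph\<close>: an edge between \<open>u\<close> and \<open>v\<close> is represented
  by the two arcs \<open>(u, v)\<close> and \<open>(v, u)\<close>.
\<close>

definition white_neighbours :: "'a pair_pre_digraph \<Rightarrow> 'a set \<Rightarrow> 'a \<Rightarrow> 'a set" where
  "white_neighbours G B u = {w \<in> pverts G. (u, w) \<in> parcs G \<and> w \<notin> B}"

text \<open>A colouring is given by its set of black vertices.\<close>

definition force_step :: "'a pair_pre_digraph \<Rightarrow> 'a set \<Rightarrow> 'a set \<Rightarrow> bool" where
  "force_step G B B' \<longleftrightarrow>
    (\<exists>u v. u \<in> B \<and> white_neighbours G B u = {v} \<and> B' = insert v B)"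

definition zero_forcing_set :: "'a pair_pre_digraph \<Rightarrow> 'a set \<Rightarrow> bool" where
  "zero_forcing_set G S \<longleftrightarrow> S \<subseteq> pverts G \<and> (force_step G)\<^sup>*\<^sup>* S (pverts G)"

definition failed_zero_forcing_set :: "'a pair_pre_digraph \<Rightarrow> 'a set \<Rightarrow> bool" where
  "failed_zero_forcing_set G S \<longleftrightarrow> S \<subseteq> pverts G \<and> \<not> zero_forcing_set G S"

definition zero_blocking_set :: "'a pair_pre_digraph \<Rightarrow> 'a set \<Rightarrow> bool" where
  "zero_blocking_set G W \<longleftrightarrow>
    W \<subseteq> pverts G \<and> failed_zero_forcing_set G (pverts G - W)"

text \<open>Meaningful for finite graphs with at least one vertex, see \<open>zero_blocking_set_pverts\<close>.\<close>

definition zero_blocking_number :: "'a pair_pre_digraph \<Rightarrow> nat" where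
  "zero_blocking_number G = Min (card ` {W. zero_blocking_set G W})"

definition johnson_graph :: "nat \<Rightarrow> nat \<Rightarrow> nat \<Rightarrow> nat set pair_pre_digraph" where
  "johnson_graph n k a =
    \<lparr> pverts = {A. A \<subseteq> {1..n} \<and> card A = k},
      parcs = {(A, B). A \<subseteq> {1..n} \<and> card A = k \<and> B \<subseteq> {1..n} \<and> card B = k \<and>
                       card (A \<inter> B) = a} \<rparr>"

lemma pair_graph_johnson_graph:
  assumes "a < k"
  shows "pair_graph (johnson_graph n k a)"
proof -
  let ?V = "{A. A \<subseteq> {1..n} \<and> card A = k}"
  have fin: "finite ?V" by simp
  have "parcs (johnson_graph n k a) \<subseteq> ?V \<times> ?V"
    by (auto simp: johnson_graph_def)
  then have "finite (parcs (johnson_graph n k a))"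
    using fin by (meson finite_SigmaI finite_subset)
  then show ?thesis
    using assms fin
    by unfold_locales
      (fastforce simp: johnson_graph_def symmetric_def Int_commute intro!: symI)+
qed

text \<open>
  The final colouring does not depend on the order in which forces are performed, so in
  \<^const>\<open>zero_forcing_set\<close> it is immaterial whether some or every maximal run is required to
  colour all vertices black.
\<close>

lemma force_step_subset_stuck:
  assumes "(force_step G)\<^sup>*\<^sup>* S U" "S \<subseteq> T" "\<And>T'. \<not> force_step G T T'"
  shows "U \<subseteq> T"
  using assms(1)
proof (induction rule: rtranclp_induct)
  case base
  then show ?case using assms(2) .
next
  case (step U U')
  then obtain u v where uv: "u \<in> U" "white_neighbours G U u = {v}" "U' = insert v U"
    by (auto simp: force_step_def)
  have "v \<in> T"
  proof (rule ccontr)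
    assume "v \<notin> T"
    then have "white_neighbours G T u = {v}"
      using uv(2) step.IH unfolding white_neighbours_def by blast
    then have "force_step G T (insert v T)"
      using uv(1) step.IH unfolding force_step_def by blast
    then show False using assms(3) by blast
  qed
  then show ?case using uv(3) step.IH by blast
qed

lemma force_step_mono:
  assumes "(force_step G)\<^sup>*\<^sup>* S U"
  shows "S \<subseteq> U"
  using assms by (induction rule: rtranclp_induct) (auto simp: force_step_def)

lemma force_step_stuck_unique:
  assumes "(force_step G)\<^sup>*\<^sup>* S T" "\<And>T'. \<not> force_step G T T'"
    and "(force_step G)\<^sup>*\<^sup>* S U" "\<And>U'. \<not> force_step G U U'"
  shows "T = U"
proof (rule subset_antisym)
  show "T \<subseteq> U"
    by (rule force_step_subset_stuck[OF assms(1) force_step_mono[OF assms(3)] assms(4)])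
  show "U \<subseteq> T"
    by (rule force_step_subset_stuck[OF assms(3) force_step_mono[OF assms(1)] assms(2)])
qed

lemma zero_blocking_set_pverts:
  assumes "pverts G \<noteq> {}"
  shows "zero_blocking_set G (pverts G)"
proof -
  have "U = {}" if "(force_step G)\<^sup>*\<^sup>* {} U" for U
    using that by (induction rule: rtranclp_induct) (auto simp: force_step_def)
  then show ?thesis
    using assms
    by (auto simp: zero_blocking_set_def failed_zero_forcing_set_def zero_forcing_set_def)
qed

end

theory Submission
  imports Defs
begin

text \<open>
  The complement of a stuck colouring is a nonempty set \<open>F\<close> of vertices such that no vertex outside
  \<open>F\<close> has exactly one neighbour in \<open>F\<close>; the zero blocking number is the least size of such a set.

  For a \<open>(k + 1)\<close>-set \<open>S\<close> and a \<open>(k - a + 2)\<close>-subset \<open>Y\<close>, the sets \<open>S - {y}\<close> with \<open>y \<in> Y\<close> form such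
  an \<open>F\<close>.

  Conversely, let \<open>F\<close> consist of at most \<open>k - a + 1\<close> sets and fix \<open>A \<in> F\<close>. Prescribing one element for
  every other member of \<open>F\<close>, one finds \<open>S \<subseteq> A\<close> of size \<open>k - a\<close> that is contained in no other member.
  Hence \<open>(A - S) \<union> X\<close> with \<open>X = \<Union>F - A\<close> meets \<open>A\<close> in \<open>a\<close> elements and all other members in more. The
  product over the other members \<open>B\<close> of \<open>\<bar>((A - S) \<union> Y) \<inter> B\<bar> - a\<close> is a polynomial of degree at most
  \<open>k - a\<close> in the indicator of \<open>Y\<close>, so that it already does not vanish at some \<open>Y \<subseteq> X\<close> with at most
  \<open>k - a\<close> elements. Filling up \<open>(A - S) \<union> Y\<close> outside \<open>\<Union>F\<close> yields a vertex with the only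
  neighbour \<open>A\<close> in \<open>F\<close>.
\<close>

section \<open>Zero blocking sets and stuck colourings\<close>

lemma zero_blocking_set_of_stuck:
  assumes "F \<subseteq> pverts G" "F \<noteq> {}" "\<And>T. \<not> force_step G (pverts G - F) T"
  shows "zero_blocking_set G F"
proof -
  have "U = pverts G - F" if "(force_step G)\<^sup>*\<^sup>* (pverts G - F) U" for U
    using that by (induction rule: rtranclp_induct) (use assms(3) in auto)
  then have "\<not> (force_step G)\<^sup>*\<^sup>* (pverts G - F) (pverts G)"
    using assms(1,2) by blast
  then show ?thesis
    using assms(1)
    by (auto simp: zero_blocking_set_def failed_zero_forcing_set_def zero_forcing_set_def)
qed

text \<open>If no nonempty subset of \<open>W\<close>, taken as the white set, were stuck, white
  vertices could be removed one at a time: a force replaces \<open>W\<close> by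
  \<open>W - {v}\<close>, which inherits the assumption, until everything is black.\<close>

lemma zero_blocking_set_contains_stuck:
  assumes "zero_blocking_set G W" "finite (pverts G)"
  obtains F where "F \<subseteq> W" "F \<noteq> {}" "\<And>T. \<not> force_step G (pverts G - F) T"
proof -
  have "(force_step G)\<^sup>*\<^sup>* (pverts G - W) (pverts G)"
    if "finite W" "\<And>F. F \<subseteq> W \<Longrightarrow> F \<noteq> {} \<Longrightarrow> \<exists>T. force_step G (pverts G - F) T" for W
    using that
  proof (induction W rule: finite_psubset_induct)
    case (psubset W)
    show ?case
    proof (cases "W = {}")
      case False
      then obtain T where T: "force_step G (pverts G - W) T"
        using psubset.prems by blast
      then obtain v where v: "v \<in> W" "v \<in> pverts G" "T = insert v (pverts G - W)"
        by (auto simp: force_step_def white_neighbours_def)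
      then have "T = pverts G - (W - {v})" by blast
      moreover have "(force_step G)\<^sup>*\<^sup>* (pverts G - (W - {v})) (pverts G)"
        by (rule psubset.IH) (use v psubset.prems in auto)
      ultimately show ?thesis
        using T by (metis converse_rtranclp_into_rtranclp)
    qed simp
  qed
  moreover have "W \<subseteq> pverts G" "\<not> (force_step G)\<^sup>*\<^sup>* (pverts G - W) (pverts G)"
    using assms(1)
    by (auto simp: zero_blocking_set_def failed_zero_forcing_set_def zero_forcing_set_def)
  ultimately show thesis
    using that assms(2) by (meson finite_subset)
qed

lemma zero_blocking_number_eqI:
  assumes "finite (pverts G)"
    and "F \<subseteq> pverts G" "F \<noteq> {}" "\<And>T. \<not> force_step G (pverts G - F) T"
    and "\<And>E. E \<subseteq> pverts G \<Longrightarrow> E \<noteq> {} \<Longrightarrow> (\<And>T. \<not> force_step G (pverts G - E) T) \<Longrightarrow> card F \<le> card E"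
  shows "zero_blocking_number G = card F"
  unfolding zero_blocking_number_def
proof (rule Min_eqI)
  have sub: "{W. zero_blocking_set G W} \<subseteq> Pow (pverts G)"
    by (auto simp: zero_blocking_set_def)
  then show "finite (card ` {W. zero_blocking_set G W})"
    using assms(1) by (meson finite_Pow_iff finite_imageI finite_subset)
  show "card F \<in> card ` {W. zero_blocking_set G W}"
    using zero_blocking_set_of_stuck[OF assms(2-4)] by blast
  show "card F \<le> y" if y: "y \<in> card ` {W. zero_blocking_set G W}" for y
  proof -
    obtain W where W: "zero_blocking_set G W" "y = card W" using y by blast
    obtain E where E: "E \<subseteq> W" "E \<noteq> {}" "\<And>T. \<not> force_step G (pverts G - E) T"
      using zero_blocking_set_contains_stuck[OF W(1) assms(1)] by blast
    have "W \<subseteq> pverts G" using sub W by blast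
    then have "card E \<le> card W"
      using assms(1) E(1) by (meson card_mono finite_subset)
    moreover have "card F \<le> card E"
      using \<open>W \<subseteq> pverts G\<close> assms(5)[of E] E by blast
    ultimately show ?thesis using W by simp
  qed
qed

section \<open>Alternating sums over subsets\<close>

lemma sum_Pow_containing:
  assumes "finite X" "x \<in> X"
  shows "(\<Sum>Y\<in>Pow X. of_bool (x \<in> Y) * f Y) = (\<Sum>Z\<in>Pow (X - {x}). f (insert x Z) :: int)"
proof -
  have "(\<Sum>Y\<in>Pow X. of_bool (x \<in> Y) * f Y) = (\<Sum>Y\<in>insert x ` Pow (X - {x}). f Y)"
  proof (rule sum.mono_neutral_cong_right)
    show "\<forall>Y\<in>Pow X - insert x ` Pow (X - {x}). of_bool (x \<in> Y) * f Y = 0"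
    proof
      fix Y assume Y: "Y \<in> Pow X - insert x ` Pow (X - {x})"
      have "x \<notin> Y"
      proof
        assume "x \<in> Y"
        then have "Y = insert x (Y - {x})" by blast
        moreover have "Y - {x} \<in> Pow (X - {x})" using Y by blast
        ultimately show False using Y by blast
      qed
      then show "of_bool (x \<in> Y) * f Y = 0" by simp
    qed
  qed (use assms in auto)
  also have "\<dots> = (\<Sum>Z\<in>Pow (X - {x}). f (insert x Z))"
    using sum.reindex[of "insert x" "Pow (X - {x})" f] by (auto simp: inj_on_def)
  finally show ?thesis .
qed

text \<open>
  The product is a polynomial of degree \<open>card I < card X\<close> in the indicator of \<open>Y\<close>, hence its
  finite difference of order \<open>card X\<close> vanishes.
\<close>

lemma alternating_sum_prod_card_inter:
  fixes s :: "'i \<Rightarrow> int"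
  assumes "finite I" "finite X" "card I < card X"
  shows "(\<Sum>Y\<in>Pow X. (-1) ^ card Y * (\<Prod>j\<in>I. int (card (Y \<inter> B j)) - s j)) = 0"
  using assms
proof (induction I arbitrary: X s rule: finite_induct)
  case empty
  then obtain x where x: "x \<in> X" by fastforce
  have fin: "finite X" by fact
  \<comment> \<open>Subsets avoiding \<open>x\<close> are paired with those containing it; the two
    signs in a pair cancel.\<close>
  have "(\<Sum>Y\<in>Pow X. (-1) ^ card Y :: int)
      = (\<Sum>Y\<in>Pow (X - {x}). (-1) ^ card Y) + (\<Sum>Y\<in>Pow X. of_bool (x \<in> Y) * (-1) ^ card Y)"
  proof -
    have "(\<Sum>Y\<in>Pow (X - {x}). (-1) ^ card Y :: int) = (\<Sum>Y\<in>Pow X. of_bool (x \<notin> Y) * (-1) ^ card Y)"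
      by (rule sum.mono_neutral_cong_left) (use fin in auto)
    then show ?thesis
      by (simp add: sum.distrib[symmetric]) (intro sum.cong, auto)
  qed
  also have "\<dots> = (\<Sum>Y\<in>Pow (X - {x}). (-1) ^ card Y + (-1) ^ card (insert x Y))"
    using sum_Pow_containing[OF fin x, of "\<lambda>Y. (-1) ^ card Y"] by (simp add: sum.distrib)
  also have "\<dots> = 0"
  proof (rule sum.neutral, rule ballI)
    fix Y assume "Y \<in> Pow (X - {x})"
    then have "finite Y" "x \<notin> Y" using fin by (auto intro: finite_subset)
    then show "(-1) ^ card Y + (-1) ^ card (insert x Y) = (0 :: int)" by simp
  qed
  finally show ?case by simp
next
  case (insert i I)
  let ?g = "\<lambda>Y. \<Prod>j\<in>I. int (card (Y \<inter> B j)) - s j"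
  have fin: "finite X" by fact
  \<comment> \<open>The factor for \<open>i\<close> is linear in the indicator of \<open>Y\<close>;
    expanding it over the points \<open>x\<close> leaves the sums treated in
    \<open>zero\<close>.\<close>
  have card_eq: "int (card (Y \<inter> B i)) = (\<Sum>x\<in>X \<inter> B i. of_bool (x \<in> Y))" if "Y \<in> Pow X" for Y
  proof -
    have "(\<Sum>x\<in>X \<inter> B i. of_bool (x \<in> Y) :: int) = int (card ({x. x \<in> Y} \<inter> (X \<inter> B i)))"
      using fin by (simp add: Int_commute)
    also have "{x. x \<in> Y} \<inter> (X \<inter> B i) = Y \<inter> B i" using that by auto
    finally show ?thesis by simp
  qed
  \<comment> \<open>Writing \<open>Y = insert x Z\<close> shifts each \<open>s j\<close> by
    \<open>of_bool (x \<in> B j)\<close>, which is why \<open>s\<close> varies in the induction. One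
    point and one factor are lost together, so \<open>card I < card (X - {x})\<close>.\<close>
  have zero: "(\<Sum>Y\<in>Pow X. of_bool (x \<in> Y) * ((-1) ^ card Y * ?g Y)) = 0" if x: "x \<in> X" for x
  proof -
    have "(\<Sum>Y\<in>Pow X. of_bool (x \<in> Y) * ((-1) ^ card Y * ?g Y))
        = (\<Sum>Z\<in>Pow (X - {x}). (-1) ^ card (insert x Z) * ?g (insert x Z))"
      by (rule sum_Pow_containing[OF fin x])
    also have "\<dots> = (\<Sum>Z\<in>Pow (X - {x}). - ((-1) ^ card Z *
        (\<Prod>j\<in>I. int (card (Z \<inter> B j)) - (s j - of_bool (x \<in> B j)))))"
    proof (rule sum.cong[OF refl])
      fix Z assume "Z \<in> Pow (X - {x})"
      then have Z: "finite Z" "x \<notin> Z" using fin by (auto intro: finite_subset)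
      then have "?g (insert x Z) = (\<Prod>j\<in>I. int (card (Z \<inter> B j)) - (s j - of_bool (x \<in> B j)))"
        by (intro prod.cong) (auto simp: Int_insert_left)
      then show "(-1) ^ card (insert x Z) * ?g (insert x Z) = - ((-1) ^ card Z *
          (\<Prod>j\<in>I. int (card (Z \<inter> B j)) - (s j - of_bool (x \<in> B j))))"
        using Z by simp
    qed
    also have "\<dots> = 0"
      using insert.IH[of "X - {x}"] insert.prems insert.hyps x by (simp add: sum_negf)
    finally show ?thesis .
  qed
  have "(\<Sum>Y\<in>Pow X. (-1) ^ card Y * (\<Prod>j\<in>insert i I. int (card (Y \<inter> B j)) - s j))
      = (\<Sum>Y\<in>Pow X. (\<Sum>x\<in>X \<inter> B i. of_bool (x \<in> Y) * ((-1) ^ card Y * ?g Y))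
          - s i * ((-1) ^ card Y * ?g Y))"
  proof (rule sum.cong[OF refl])
    fix Y assume "Y \<in> Pow X"
    then show "(-1) ^ card Y * (\<Prod>j\<in>insert i I. int (card (Y \<inter> B j)) - s j)
      = (\<Sum>x\<in>X \<inter> B i. of_bool (x \<in> Y) * ((-1) ^ card Y * ?g Y)) - s i * ((-1) ^ card Y * ?g Y)"
      using insert.hyps
      by (simp only: sum_distrib_right[symmetric] card_eq[symmetric])
        (simp add: algebra_simps)
  qed
  also have "\<dots> = (\<Sum>x\<in>X \<inter> B i. \<Sum>Y\<in>Pow X. of_bool (x \<in> Y) * ((-1) ^ card Y * ?g Y))
      - s i * (\<Sum>Y\<in>Pow X. (-1) ^ card Y * ?g Y)"
    by (simp only: sum_subtractf sum_distrib_left sum.swap[of _ "X \<inter> B i" "Pow X"])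
  also have "\<dots> = 0"
  proof -
    have "(\<Sum>Y\<in>Pow X. (-1) ^ card Y * ?g Y) = 0"
      using insert.IH[of X s] insert.prems insert.hyps by simp
    moreover have "(\<Sum>x\<in>X \<inter> B i. \<Sum>Y\<in>Pow X. of_bool (x \<in> Y) * ((-1) ^ card Y * ?g Y)) = 0"
      by (intro sum.neutral ballI zero) simp
    ultimately show ?thesis by simp
  qed
  finally show ?case .
qed

text \<open>While \<open>X\<close> has more than \<open>card I\<close> elements, the alternating sum
  of the product vanishes but its term at \<open>X\<close> does not. Hence some proper subset also
  gives a nonzero product, and one descends to it.\<close>

lemma small_subset_avoiding_cards:
  fixes s :: "'i \<Rightarrow> int"
  assumes "finite I" "finite X" "\<forall>j\<in>I. int (card (X \<inter> B j)) \<noteq> s j"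
  obtains Y where "Y \<subseteq> X" "card Y \<le> card I" "\<forall>j\<in>I. int (card (Y \<inter> B j)) \<noteq> s j"
proof -
  have "\<exists>Y\<subseteq>X. card Y \<le> card I \<and> (\<forall>j\<in>I. int (card (Y \<inter> B j)) \<noteq> s j)"
    using assms(2,3)
  proof (induction X rule: finite_psubset_induct)
    case (psubset X)
    let ?h = "\<lambda>Y. \<Prod>j\<in>I. int (card (Y \<inter> B j)) - s j"
    have h_iff: "?h Y \<noteq> 0 \<longleftrightarrow> (\<forall>j\<in>I. int (card (Y \<inter> B j)) \<noteq> s j)" for Y
      using assms(1) by (simp add: prod_zero_iff)
    show ?case
    proof (cases "card X \<le> card I")
      case False
      have "\<exists>Y. Y \<subset> X \<and> ?h Y \<noteq> 0"
      proof (rule ccontr)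
        assume none: "\<nexists>Y. Y \<subset> X \<and> ?h Y \<noteq> 0"
        have "(\<Sum>Y\<in>Pow X. (-1) ^ card Y * ?h Y) = (\<Sum>Y\<in>{X}. (-1) ^ card Y * ?h Y)"
          by (rule sum.mono_neutral_right) (use none psubset.hyps in auto)
        moreover have "(\<Sum>Y\<in>Pow X. (-1) ^ card Y * ?h Y) = 0"
          by (rule alternating_sum_prod_card_inter) (use False assms(1) psubset.hyps in auto)
        ultimately have "?h X = 0" by simp
        then show False using h_iff psubset.prems by blast
      qed
      then obtain Y where "Y \<subset> X" "?h Y \<noteq> 0" by blast
      then show ?thesis
        using psubset.IH[of Y] h_iff by (meson psubset_imp_subset subset_trans)
    qed (use psubset.prems in blast)
  qed
  then show thesis using that by blast
qed

section \<open>Sets meeting exactly one member of a family in \<open>a\<close> elements\<close>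

lemma subset_not_contained_in_others:
  assumes "finite F" "A \<in> F" "\<And>B. B \<in> F \<Longrightarrow> finite B \<and> card B = k"
    and "card F \<le> k - a + 1" "2 * a < k" "1 \<le> a"
  obtains S where "S \<subseteq> A" "card S = k - a" "\<And>B. B \<in> F - {A} \<Longrightarrow> \<not> S \<subseteq> B"
    "\<And>B. B \<in> F \<Longrightarrow> card (A \<inter> B) = a \<Longrightarrow> S \<inter> B \<noteq> {}"
proof -
  \<comment> \<open>If \<open>A \<inter> B\<close> has size \<open>a\<close>, then
    \<open>k - a > a\<close> alone excludes \<open>S \<subseteq> B\<close>, so the element
    prescribed for \<open>B\<close> is free to make \<open>S\<close> meet \<open>B\<close>.
    Otherwise it must witness \<open>\<not> S \<subseteq> B\<close>.\<close>
  define P where "P B e \<longleftrightarrow> e \<in> A \<and> (if card (A \<inter> B) = a then e \<in> B else e \<notin> B)" for B e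
  have A: "finite A" "card A = k" using assms(2,3) by auto
  have "\<exists>e. P B e" if B: "B \<in> F - {A}" for B
  proof (cases "card (A \<inter> B) = a")
    case True
    then have "A \<inter> B \<noteq> {}" using assms(6) by auto
    then show ?thesis using True by (auto simp: P_def)
  next
    case False
    have "\<not> A \<subseteq> B" using B A assms(3) by (metis DiffD1 DiffD2 card_subset_eq singletonI)
    then show ?thesis using False by (auto simp: P_def)
  qed
  then obtain e where e: "\<And>B. B \<in> F - {A} \<Longrightarrow> P B (e B)" by metis
  have "card (e ` (F - {A})) \<le> card (F - {A})"
    by (rule card_image_le) (use assms(1) in auto)
  also have "\<dots> \<le> k - a" using assms(1,2,4) by simp
  finally have "card (e ` (F - {A})) \<le> k - a" .
  moreover have "e ` (F - {A}) \<subseteq> A" using e by (auto simp: P_def)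
  ultimately obtain S where S: "e ` (F - {A}) \<subseteq> S" "S \<subseteq> A" "card S = k - a"
    using exists_subset_between[of "e ` (F - {A})" "k - a" A] A by auto
  show thesis
  proof (rule that[OF S(2,3)])
    show "\<not> S \<subseteq> B" if B: "B \<in> F - {A}" for B
    proof
      assume SB: "S \<subseteq> B"
      have "card S \<le> card (A \<inter> B)"
        by (rule card_mono) (use SB S(2) A in auto)
      then have "card (A \<inter> B) \<noteq> a" using S(3) assms(5) by auto
      then have "e B \<notin> B" using e[OF B] by (simp add: P_def)
      then show False using SB S(1) B by blast
    qed
    show "S \<inter> B \<noteq> {}" if B: "B \<in> F" "card (A \<inter> B) = a" for B
    proof -
      have "B \<noteq> A" using B A assms(5) by auto
      then have "B \<in> F - {A}" using B by simp
      moreover from e[OF this] B have "e B \<in> B" by (simp add: P_def)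
      ultimately show ?thesis using S(1) by blast
    qed
  qed
qed

text \<open>The last conclusion keeps the vertex obtained by filling up \<open>T\<close> outside
  \<open>\<Union>F\<close> from being a member of \<open>F\<close>: its intersection with
  \<open>A\<close> is \<open>T \<inter> A\<close>, which has size \<open>a\<close> and lies in
  \<open>T\<close>.\<close>

lemma exists_set_meeting_exactly_one:
  assumes "finite F" "A \<in> F" "\<And>B. B \<in> F \<Longrightarrow> finite B \<and> card B = k"
    and "card F \<le> k - a + 1" "2 * a < k" "1 \<le> a"
  obtains T where "T \<subseteq> \<Union>F" "a \<le> card T" "card T \<le> k" "card (T \<inter> A) = a"
    "\<And>B. B \<in> F - {A} \<Longrightarrow> card (T \<inter> B) \<noteq> a"
    "\<And>B. B \<in> F \<Longrightarrow> card (A \<inter> B) = a \<Longrightarrow> \<not> A \<inter> B \<subseteq> T"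
proof -
  obtain S where S: "S \<subseteq> A" "card S = k - a" "\<And>B. B \<in> F - {A} \<Longrightarrow> \<not> S \<subseteq> B"
    "\<And>B. B \<in> F \<Longrightarrow> card (A \<inter> B) = a \<Longrightarrow> S \<inter> B \<noteq> {}"
    using subset_not_contained_in_others[OF assms] by blast
  define X where "X = \<Union>F - A"
  have A: "finite A" "card A = k" using assms(2,3) by auto
  have finS: "finite S" using S(1) A by (auto intro: finite_subset)
  have card_AS: "card (A - S) = a"
    using card_Diff_subset[OF finS S(1)] S(2) A assms(5) by simp
  have finX: "finite X" using assms(1,3) by (auto simp: X_def)
  have split: "card ((A - S \<union> Y) \<inter> B) = card ((A - S) \<inter> B) + card (Y \<inter> B)" if "Y \<subseteq> X" for Y B
  proof -
    have "finite Y" using that finX by (rule finite_subset)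
    moreover have "(A - S) \<inter> B \<inter> (Y \<inter> B) = {}" using that by (auto simp: X_def)
    ultimately have "card ((A - S) \<inter> B \<union> Y \<inter> B) = card ((A - S) \<inter> B) + card (Y \<inter> B)"
      using A by (intro card_Un_disjoint) auto
    then show ?thesis by (simp add: Int_Un_distrib2)
  qed
  \<comment> \<open>With all of \<open>X\<close> added, only \<open>S \<inter> B\<close> is missing
    from \<open>B\<close>. It has fewer than \<open>k - a\<close> elements, so more than
    \<open>a\<close> remain.\<close>
  have "\<forall>B\<in>F - {A}. int (card (X \<inter> B)) \<noteq> int a - int (card ((A - S) \<inter> B))"
  proof
    fix B assume B: "B \<in> F - {A}"
    then have "finite B" "card B = k" using assms(3) by auto
    have "S \<inter> B \<subset> S" using S(3)[OF B] by blast
    then have "card (S \<inter> B) < k - a" using finS S(2) by (metis psubset_card_mono)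
    moreover have "(A - S \<union> X) \<inter> B = B - S \<inter> B" using B S(1) by (auto simp: X_def)
    then have "card ((A - S \<union> X) \<inter> B) = k - card (S \<inter> B)"
      using \<open>card B = k\<close> finS by (simp add: card_Diff_subset)
    ultimately have "card ((A - S \<union> X) \<inter> B) > a" by linarith
    then show "int (card (X \<inter> B)) \<noteq> int a - int (card ((A - S) \<inter> B))"
      using split[of X B] by simp
  qed
  then obtain Y where Y: "Y \<subseteq> X" "card Y \<le> card (F - {A})"
    "\<forall>B\<in>F - {A}. int (card (Y \<inter> B)) \<noteq> int a - int (card ((A - S) \<inter> B))"
    using small_subset_avoiding_cards[of "F - {A}" X "\<lambda>B. B" "\<lambda>B. int a - int (card ((A - S) \<inter> B))"]
      assms(1) finX by auto
  have "card Y \<le> k - a" using Y(2) assms(1,2,4) by simp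
  moreover have "card (A - S \<union> Y) = a + card Y"
    using split[OF Y(1), of UNIV] card_AS by simp
  moreover have TA: "(A - S \<union> Y) \<inter> A = A - S" using Y(1) by (auto simp: X_def)
  ultimately show thesis
  proof (intro that[of "A - S \<union> Y"])
    show "A - S \<union> Y \<subseteq> \<Union>F" using Y(1) assms(2) by (auto simp: X_def)
    show "card ((A - S \<union> Y) \<inter> B) \<noteq> a" if "B \<in> F - {A}" for B
      using bspec[OF Y(3) that] split[OF Y(1), of B] by linarith
    show "\<not> A \<inter> B \<subseteq> A - S \<union> Y" if "B \<in> F" "card (A \<inter> B) = a" for B
      using S(4)[OF that] S(1) TA by blast
  qed (use card_AS assms(5) in auto)
qed

section \<open>Stuck colourings of generalized Johnson graphs\<close>

lemma pverts_johnson_graph [simp]: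
  "pverts (johnson_graph n k a) = {A. A \<subseteq> {1..n} \<and> card A = k}"
  by (simp add: johnson_graph_def)

lemma white_neighbours_johnson_graph:
  assumes "F \<subseteq> pverts (johnson_graph n k a)" "U \<in> pverts (johnson_graph n k a)"
  shows "white_neighbours (johnson_graph n k a) (pverts (johnson_graph n k a) - F) U
    = {A \<in> F. card (U \<inter> A) = a}"
  using assms by (auto simp: white_neighbours_def johnson_graph_def)

text \<open>The bound on \<open>n\<close> leaves room for the filling: at most
  \<open>k - a + 1\<close> sets cover at most \<open>k * (k - a + 1)\<close> points, so at least
  \<open>k - a\<close> points stay free, and \<open>T\<close> already has \<open>a\<close> elements
  or more.\<close>

lemma johnson_graph_stuck_card_ge:
  fixes n k a :: nat
  defines "G \<equiv> johnson_graph n k a"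
  assumes n: "k * (k - a + 2) - a \<le> n" and a: "2 * a < k" "1 \<le> a"
    and F: "F \<subseteq> pverts G" "F \<noteq> {}" and stuck: "\<And>T. \<not> force_step G (pverts G - F) T"
  shows "k - a + 2 \<le> card F"
proof (rule ccontr)
  assume "\<not> ?thesis"
  then have cardF: "card F \<le> k - a + 1" by simp
  have finF: "finite F" using F(1) by (rule finite_subset) (simp add: G_def)
  have mem: "B \<subseteq> {1..n} \<and> card B = k \<and> finite B" if "B \<in> F" for B
    using that F(1) by (auto simp: G_def intro: finite_subset)
  obtain A where A: "A \<in> F" using F(2) by blast
  obtain T where T: "T \<subseteq> \<Union>F" "a \<le> card T" "card T \<le> k" "card (T \<inter> A) = a"
    "\<And>B. B \<in> F - {A} \<Longrightarrow> card (T \<inter> B) \<noteq> a"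
    "\<And>B. B \<in> F \<Longrightarrow> card (A \<inter> B) = a \<Longrightarrow> \<not> A \<inter> B \<subseteq> T"
    using exists_set_meeting_exactly_one[OF finF A _ cardF a] mem by blast
  have Un: "\<Union>F \<subseteq> {1..n}" using mem by blast
  have "card (\<Union>F) \<le> card F * k"
    using card_Union_le_sum_card[of F] mem by simp
  also have "\<dots> \<le> (k - a + 1) * k" using cardF by (rule mult_right_mono) simp
  finally have "card (\<Union>F) \<le> k * (k - a + 2) - k" by (simp add: algebra_simps)
  \<comment> \<open>This makes the preceding subtraction of \<open>k\<close> exact.\<close>
  moreover have "k * (k - a + 2) \<ge> k" by simp
  ultimately have "k - a \<le> n - card (\<Union>F)" using n a by linarith
  also have "\<dots> = card ({1..n} - \<Union>F)"
    using Un by (simp add: card_Diff_subset finite_subset)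
  finally have "k - card T \<le> card ({1..n} - \<Union>F)" using T(2) by linarith
  then obtain R where R: "R \<subseteq> {1..n} - \<Union>F" "card R = k - card T" "finite R"
    by (metis obtain_subset_with_card_n)
  define U where "U = T \<union> R"
  have "finite T" "T \<inter> R = {}" using T(1) Un R by (auto intro: finite_subset)
  then have "card U = k" using R T(3) by (simp add: U_def card_Un_disjoint)
  then have U: "U \<in> pverts G" using T(1) Un R by (auto simp: U_def G_def)
  have UB: "U \<inter> B = T \<inter> B" if "B \<in> F" for B using that R by (auto simp: U_def)
  have "U \<notin> F"
  proof
    assume "U \<in> F"
    moreover have "A \<inter> U = T \<inter> A" using UB[OF A] by blast
    ultimately show False using T(4) T(6)[of U] by auto
  qed
  moreover have "white_neighbours G (pverts G - F) U = {A}"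
  proof -
    have "{B \<in> F. card (U \<inter> B) = a} = {A}"
    proof (intro equalityI subsetI)
      show "B \<in> {A}" if "B \<in> {B \<in> F. card (U \<inter> B) = a}" for B
        using that UB[of B] T(5)[of B] by auto
    qed (use A T(4) UB in auto)
    then show ?thesis
      using white_neighbours_johnson_graph[OF F(1)[unfolded G_def] U[unfolded G_def]]
      by (simp only: G_def)
  qed
  ultimately show False using stuck[of "insert A (pverts G - F)"] U
    unfolding force_step_def by blast
qed

text \<open>Removing \<open>z\<close> from \<open>S\<close> lowers the intersection with
  \<open>U\<close> by one exactly if \<open>z \<in> U\<close>. A unique neighbour
  \<open>S - {y}\<close> thus separates \<open>y\<close> from all other points of \<open>Y\<close>
  with respect to \<open>U\<close>, and either way a count fails.\<close>

lemma johnson_graph_stuck_example: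
  fixes n k a :: nat
  defines "G \<equiv> johnson_graph n k a"
  assumes n: "k < n" and a: "2 * a < k" "1 \<le> a"
  obtains F where "F \<subseteq> pverts G" "card F = k - a + 2" "\<And>T. \<not> force_step G (pverts G - F) T"
proof -
  \<comment> \<open>As \<open>a \<ge> 1\<close>, \<open>Y\<close> fits into \<open>S\<close> and
    leaves exactly \<open>a - 1\<close> elements of \<open>S\<close> uncovered.\<close>
  define S Y where "S = {1..k + 1}" and "Y = {1..k - a + 2}"
  define F where "F = (\<lambda>y. S - {y}) ` Y"
  have S: "finite S" "card S = k + 1" "S \<subseteq> {1..n}" using n by (auto simp: S_def)
  have Y: "finite Y" "card Y = k - a + 2" "Y \<subseteq> S" using a by (auto simp: S_def Y_def)
  have FV: "F \<subseteq> pverts G" using S Y by (auto simp: F_def G_def)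
  have inj: "inj_on (\<lambda>y. S - {y}) Y" using Y(3) by (auto simp: inj_on_def)
  have no_step: "\<not> force_step G (pverts G - F) T" for T
  proof
    assume "force_step G (pverts G - F) T"
    then obtain U A where U: "U \<in> pverts G" "white_neighbours G (pverts G - F) U = {A}"
      by (auto simp: force_step_def)
    have finU: "finite U" using U(1) by (auto simp: G_def intro: finite_subset)
    have "white_neighbours G (pverts G - F) U = {B \<in> F. card (U \<inter> B) = a}"
      using white_neighbours_johnson_graph[OF FV[unfolded G_def] U(1)[unfolded G_def]]
      by (simp only: G_def)
    then have A: "{B \<in> F. card (U \<inter> B) = a} = {A}" using U(2) by simp
    then have "A \<in> F" by blast
    then obtain y where yA: "y \<in> Y" "A = S - {y}" unfolding F_def by blast
    note y = yA(1)
    have y_iff: "card (U \<inter> (S - {z})) = a \<longleftrightarrow> z = y" if "z \<in> Y" for z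
    proof -
      have "card (U \<inter> (S - {z})) = a \<longleftrightarrow> S - {z} \<in> {B \<in> F. card (U \<inter> B) = a}"
        using that by (simp add: F_def)
      also have "\<dots> \<longleftrightarrow> S - {z} = S - {y}" unfolding A yA(2) by simp
      also have "\<dots> \<longleftrightarrow> z = y" using inj that yA(1) by (auto dest: inj_onD)
      finally show "card (U \<inter> (S - {z})) = a \<longleftrightarrow> z = y" .
    qed
    have card_z: "card (U \<inter> (S - {z})) = card (U \<inter> S) - of_bool (z \<in> U)" if "z \<in> Y" for z
    proof -
      have "U \<inter> (S - {z}) = U \<inter> S - {z}" by blast
      then show ?thesis using that Y(3) finU by (auto simp: card_Diff_singleton)
    qed
    show False
    proof (cases "y \<in> U")
      \<comment> \<open>\<open>U \<inter> S\<close> needs \<open>a + 1\<close> elements, but only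
        \<open>y\<close> and the \<open>a - 1\<close> elements of \<open>S - Y\<close> are
        available.\<close>
      case True
      have pos: "card (U \<inter> S) > 0" using True y Y(3) finU by (auto simp: card_gt_0_iff)
      have card_US: "card (U \<inter> S) = a + 1" using card_z[OF y] y_iff[OF y] pos True by simp
      have "z = y" if "z \<in> U \<inter> Y" for z
        using that y_iff[of z] card_z[of z] card_US by simp
      then have "U \<inter> S \<subseteq> insert y (S - Y)" by blast
      then have "card (U \<inter> S) \<le> card (insert y (S - Y))"
        using S by (intro card_mono) auto
      moreover have "card (insert y (S - Y)) \<le> Suc (card (S - Y))"
        by (rule card_insert_le_m1) auto
      moreover have "card (S - Y) = a - 1" using S Y a by (simp add: card_Diff_subset)
      ultimately show False using card_US a by simp
    next
      \<comment> \<open>The \<open>k - a + 1\<close> other points of \<open>Y\<close> would all lie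
        in \<open>U \<inter> S\<close>, which has only \<open>a\<close> elements.\<close>
      case False
      then have card_US: "card (U \<inter> S) = a" using card_z[OF y] y_iff[OF y] by simp
      have "z \<in> U" if "z \<in> Y - {y}" for z
        using that y_iff[of z] card_z[of z] card_US by (cases "z \<in> U") simp_all
      then have "Y - {y} \<subseteq> U \<inter> S" using Y(3) by blast
      then have "card (Y - {y}) \<le> card (U \<inter> S)" using finU by (intro card_mono) auto
      then show False using card_US y Y a by simp
    qed
  qed
  show thesis
    by (rule that[OF FV _ no_step]) (use inj Y in \<open>simp add: F_def card_image\<close>)
qed

theorem theorem17:
  fixes n k a :: nat
  assumes "n \<ge> k" and "k > a" and "a \<ge> 0"
    and "n \<ge> k * (k - a + 2) - a"
    and "real k / 2 > real a" and "a \<ge> 1"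
  shows "zero_blocking_number (johnson_graph n k a) = k - a + 2"
proof -
  let ?G = "johnson_graph n k a"
  have a: "2 * a < k" using assms(5) by linarith
  \<comment> \<open>Since \<open>k - a + 2\<close> is at least 3, \<open>n\<close> exceeds
    \<open>k\<close>, so a \<open>(k + 1)\<close>-set exists for the example.\<close>
  have "k * 3 \<le> k * (k - a + 2)" using assms(2) by (intro mult_left_mono) auto
  then have "k < n" using assms(4) a by linarith
  then obtain F where F: "F \<subseteq> pverts ?G" "card F = k - a + 2"
    "\<And>T. \<not> force_step ?G (pverts ?G - F) T"
    using johnson_graph_stuck_example[OF _ a assms(6)] by blast
  have "zero_blocking_number ?G = card F"
  proof (rule zero_blocking_number_eqI)
    show "finite (pverts ?G)" by simp
    show "card F \<le> card E"
      if "E \<subseteq> pverts ?G" "E \<noteq> {}" "\<And>T. \<not> force_step ?G (pverts ?G - E) T" for E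
      using johnson_graph_stuck_card_ge[OF assms(4) a assms(6) that] F(2) by simp
  qed (use F in auto)
  then show ?thesis using F(2) by simp
qed

end
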